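(* Let $(\mathscr M,g)$ be a pp-wave space-time of dimension $d+2\ge 4$ with the metric $ds^2=2\,du\,dv+H(\vec x,u)\,du^2+\sum_{\rho=1}^d (dx^\rho)^2$. If $\psi=-\tfrac12\sum_{\rho=1}^d \partial^2H/\partial (x^{\rho})^2$ only depends on $u$, then $\nabla^2R_{kl}=0$.
   Context: $\nabla$ is the Levi-Civita connection, $\nabla^2=\nabla^k\nabla_k$, and $R_{kl}$ is the Ricci tensor. The metric is written in local coordinates $(u,\vec x,v)$, $\vec x=(x^1,\dots,x^d)$, with $H(\vec x,u)$ a smooth function independent of $v$. A pp-wave is a Lorentzian manifold with a (non-zero) null covariantly constant vector field ($X^iX_i=0$, $\nabla_jX_k=0$) and $R_{jk}{}^{pq}R_{pqlm}=0$; pp-waves are exactly the Lorentzian manifolds that admit local coordinates $(u,\vec x,v)$ in which the metric is $ds^2=2\,du\,dv+H(\vec x,u)\,du^2+\sum_{\rho=1}^d (dx^\rho)^2$, and then $X_k=\nabla_k u$. *)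

theory Defs
  imports "HOL-Analysis.Analysis"
begin

section \<open>Smooth functions and partial derivatives\<close>

text \<open>Meaningful for open \<open>S\<close>; all uses below are on open sets.\<close>

primrec Ck_on :: "nat \<Rightarrow> 'a::real_normed_vector set \<Rightarrow> ('a \<Rightarrow> 'b::real_normed_vector) \<Rightarrow> bool" where
  "Ck_on 0 S f \<longleftrightarrow> continuous_on S f"
| "Ck_on (Suc k) S f \<longleftrightarrow> (\<forall>x\<in>S. f differentiable (at x)) \<and>
     (\<forall>v. Ck_on k S (\<lambda>x. frechet_derivative f (at x) v))"

definition smooth_on :: "'a::real_normed_vector set \<Rightarrow> ('a \<Rightarrow> 'b::real_normed_vector) \<Rightarrow> bool" where
  "smooth_on S f \<longleftrightarrow> (\<forall>k. Ck_on k S f)"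

definition pderiv_at :: "'n::finite \<Rightarrow> (real ^ 'n \<Rightarrow> real) \<Rightarrow> real ^ 'n \<Rightarrow> real" where
  "pderiv_at i f p = deriv (\<lambda>t. f (p + t *\<^sub>R axis i 1)) 0"


section \<open>Tensor calculus in a coordinate domain\<close>

text \<open>
  A metric on a coordinate domain is given by the matrix \<open>g p\<close> of its components at \<open>p\<close>.
  A covariant tensor field of rank \<open>r\<close> is given by its components, indexed by lists of
  length \<open>r\<close>; values at lists of other lengths are irrelevant.
\<close>

type_synonym 'n metric = "real ^ 'n \<Rightarrow> real ^ 'n ^ 'n"
type_synonym 'n cotensor = "'n list \<Rightarrow> real ^ 'n \<Rightarrow> real"

definition inv_metric :: "'n::finite metric \<Rightarrow> 'n metric" where
  "inv_metric g p = matrix_inv (g p)"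

text \<open>Congruence to \<open>diag(-1, 1, \<dots>, 1)\<close>, the position of the entry \<open>-1\<close> being immaterial.\<close>

definition lorentzian_form :: "real ^ 'n ^ 'n::finite \<Rightarrow> bool" where
  "lorentzian_form A \<longleftrightarrow> (\<exists>(P :: real ^ 'n ^ 'n) i0. invertible P \<and>
     transpose P ** A ** P = (\<chi> i j. if i \<noteq> j then 0 else if i = i0 then -1 else 1))"

definition lorentzian_metric_on :: "(real ^ 'n::finite) set \<Rightarrow> 'n metric \<Rightarrow> bool" where
  "lorentzian_metric_on W g \<longleftrightarrow> open W \<and>
     (\<forall>i j. smooth_on W (\<lambda>p. g p $ i $ j)) \<and>
     (\<forall>p\<in>W. transpose (g p) = g p \<and> lorentzian_form (g p))"

text \<open>\<open>christoffel g k i j\<close> is the coefficient \<open>\<Gamma>\<^sup>k\<^sub>i\<^sub>j\<close> of the Levi-Civita connection.\<close>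

definition christoffel :: "'n::finite metric \<Rightarrow> 'n \<Rightarrow> 'n \<Rightarrow> 'n \<Rightarrow> real ^ 'n \<Rightarrow> real" where
  "christoffel g k i j p = 1/2 * (\<Sum>l\<in>UNIV. inv_metric g p $ k $ l *
     (pderiv_at i (\<lambda>q. g q $ l $ j) p + pderiv_at j (\<lambda>q. g q $ l $ i) p
        - pderiv_at l (\<lambda>q. g q $ i $ j) p))"

text \<open>The derivative index comes first: \<open>cov_deriv g T (m # is)\<close> is \<open>\<nabla>\<^sub>m T\<^sub>i\<^sub>s\<close>.\<close>

fun cov_deriv :: "'n::finite metric \<Rightarrow> 'n cotensor \<Rightarrow> 'n cotensor" where
  "cov_deriv g T (m # is) p = pderiv_at m (T is) p
     - (\<Sum>a<length is. \<Sum>s\<in>UNIV. christoffel g s m (is ! a) p * T (is[a := s]) p)"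
| "cov_deriv g T [] p = 0"

text \<open>\<open>\<nabla>\<^sup>2 T = \<nabla>\<^sup>k \<nabla>\<^sub>k T = g\<^sup>j\<^sup>k \<nabla>\<^sub>j \<nabla>\<^sub>k T\<close>\<close>

definition cov_laplacian :: "'n::finite metric \<Rightarrow> 'n cotensor \<Rightarrow> 'n cotensor" where
  "cov_laplacian g T is p = (\<Sum>j\<in>UNIV. \<Sum>k\<in>UNIV.
     inv_metric g p $ j $ k * cov_deriv g (cov_deriv g T) (j # k # is) p)"

text \<open>\<open>riemann_up g i j k l\<close> is \<open>R\<^sup>i\<^sub>j\<^sub>k\<^sub>l\<close>, where
  \<open>(\<nabla>\<^sub>k \<nabla>\<^sub>l - \<nabla>\<^sub>l \<nabla>\<^sub>k) X\<^sup>i = R\<^sup>i\<^sub>j\<^sub>k\<^sub>l X\<^sup>j\<close>; the Ricci tensor is \<open>R\<^sub>k\<^sub>l = R\<^sup>i\<^sub>k\<^sub>i\<^sub>l\<close>.\<close>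

definition riemann_up :: "'n::finite metric \<Rightarrow> 'n \<Rightarrow> 'n \<Rightarrow> 'n \<Rightarrow> 'n \<Rightarrow> real ^ 'n \<Rightarrow> real" where
  "riemann_up g i j k l p =
     pderiv_at k (christoffel g i l j) p - pderiv_at l (christoffel g i k j) p
     + (\<Sum>s\<in>UNIV. christoffel g i k s p * christoffel g s l j p
                 - christoffel g i l s p * christoffel g s k j p)"

definition riemann :: "'n::finite metric \<Rightarrow> 'n \<Rightarrow> 'n \<Rightarrow> 'n \<Rightarrow> 'n \<Rightarrow> real ^ 'n \<Rightarrow> real" where
  "riemann g i j k l p = (\<Sum>s\<in>UNIV. g p $ i $ s * riemann_up g s j k l p)"

fun ricci :: "'n::finite metric \<Rightarrow> 'n cotensor" where
  "ricci g [k, l] p = (\<Sum>i\<in>UNIV. riemann_up g i k i l p)"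
| "ricci g _ p = 0"

fun lower :: "'n::finite metric \<Rightarrow> (real ^ 'n \<Rightarrow> real ^ 'n) \<Rightarrow> 'n cotensor" where
  "lower g X [k] p = (\<Sum>i\<in>UNIV. g p $ k $ i * X p $ i)"
| "lower g X _ p = 0"


section \<open>pp-waves\<close>

text \<open>
  The vector field is required to be nowhere zero. On a connected domain this is the
  same as not being identically zero, since it is covariantly constant.
\<close>

definition pp_wave_on :: "(real ^ 'n::finite) set \<Rightarrow> 'n metric \<Rightarrow> bool" where
  "pp_wave_on W g \<longleftrightarrow> lorentzian_metric_on W g \<and>
     (\<exists>X. smooth_on W X \<and>
        (\<forall>p\<in>W. X p \<noteq> 0 \<and>
           (\<Sum>i\<in>UNIV. X p $ i * lower g X [i] p) = 0 \<and>
           (\<forall>j k. cov_deriv g (lower g X) [j, k] p = 0))) \<and>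
     (\<forall>p\<in>W. \<forall>j k l m.
        (\<Sum>p'\<in>UNIV. \<Sum>q'\<in>UNIV.
           (\<Sum>a\<in>UNIV. \<Sum>b\<in>UNIV. inv_metric g p $ p' $ a * inv_metric g p $ q' $ b * riemann g j k a b p)
           * riemann g p' q' l m p) = 0)"

text \<open>The coordinates are \<open>(u, x\<^sup>1, \<dots>, x\<^sup>d, v)\<close> with \<open>d = CARD('d)\<close>.\<close>

datatype 'd coord = U | X 'd | V

lemma UNIV_coord: "(UNIV :: 'd coord set) = insert U (insert V (range X))"
  by (auto intro: coord.exhaust)

instance coord :: (finite) finite
  by standard (simp add: UNIV_coord)

lemma CARD_coord: "CARD('d::finite coord) = CARD('d) + 2"
  by (subst UNIV_coord) (auto simp: card_insert_if card_image inj_on_def)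

definition spatial :: "real ^ ('d::finite) coord \<Rightarrow> real ^ 'd" where
  "spatial p = (\<chi> \<rho>. p $ X \<rho>)"

text \<open>The component matrix of
  \<open>ds\<^sup>2 = 2 du dv + H(x, u) du\<^sup>2 + \<Sum>\<^sub>\<rho> (dx\<^sup>\<rho>)\<^sup>2\<close>.\<close>

fun pp_component :: "real \<Rightarrow> 'd coord \<Rightarrow> 'd coord \<Rightarrow> real" where
  "pp_component h U U = h"
| "pp_component h U V = 1"
| "pp_component h V U = 1"
| "pp_component h (X \<rho>) (X \<sigma>) = (if \<rho> = \<sigma> then 1 else 0)"
| "pp_component h _ _ = 0"

definition pp_metric :: "(real ^ 'd \<Rightarrow> real \<Rightarrow> real) \<Rightarrow> 'd::finite coord metric" where
  "pp_metric H p = (\<chi> i j. pp_component (H (spatial p) (p $ U)) i j)"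

definition pp_psi :: "(real ^ 'd::finite \<Rightarrow> real \<Rightarrow> real) \<Rightarrow> real ^ 'd \<Rightarrow> real \<Rightarrow> real" where
  "pp_psi H x u = - 1/2 * (\<Sum>\<rho>\<in>UNIV. pderiv_at \<rho> (pderiv_at \<rho> (\<lambda>y. H y u)) x)"

end

theory Submission
  imports Defs
begin

text \<open>
  In these coordinates no Christoffel symbol has an upper index \<open>u\<close>, and the only nonzero
  component of the Ricci tensor is \<open>R\<^sub>u\<^sub>u = \<psi>\<close>. Since \<open>du\<close> is parallel, if \<open>\<psi>\<close> depends on \<open>u\<close>
  only, then \<open>\<nabla>\<nabla>R\<close> has only its component \<open>\<psi>''\<close> along \<open>du \<otimes> du \<otimes> du \<otimes> du\<close>, which is killed by
  the contraction with \<open>g\<^sup>u\<^sup>u = 0\<close>.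
\<close>

section \<open>Sums over the coordinates and partial derivatives\<close>

lemma sum_UNIV_coord:
  fixes f :: "'d::finite coord \<Rightarrow> 'b::comm_monoid_add"
  shows "sum f UNIV = f U + f V + (\<Sum>\<rho>\<in>UNIV. f (X \<rho>))"
proof -
  have "sum f (range X) = (\<Sum>\<rho>\<in>UNIV. f (X \<rho>))"
    by (simp add: sum.reindex inj_on_def)
  then show ?thesis
    by (subst UNIV_coord) (auto simp: image_iff add_ac)
qed

lemma pderiv_at_const [simp]: "pderiv_at i (\<lambda>_. c) p = 0"
  by (simp add: pderiv_at_def)

lemma eventually_line_in_open:
  fixes p :: "'a::real_normed_vector"
  assumes "open S" "p \<in> S"
  shows "\<forall>\<^sub>F t in nhds 0. p + t *\<^sub>R e \<in> S"
proof -
  have "((\<lambda>t. p + t *\<^sub>R e) \<longlongrightarrow> p + 0 *\<^sub>R e) (nhds 0)"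
    by (intro tendsto_intros filterlim_ident)
  then show ?thesis
    using assms by (auto dest: topological_tendstoD)
qed

text \<open>A line through a point of an open set stays inside for small parameters, and the
  derivative at 0 sees no others. Identities known only on \<open>W\<close> can thus be
  differentiated there.\<close>

lemma pderiv_at_cong:
  assumes "open S" "p \<in> S" "\<And>q. q \<in> S \<Longrightarrow> f q = h q"
  shows "pderiv_at i f p = pderiv_at i h p"
  unfolding pderiv_at_def
  using eventually_line_in_open[OF assms(1,2), of "axis i 1"]
  by (intro deriv_cong_ev refl) (auto elim!: eventually_mono intro: assms(3))

text \<open>The chain rule along a line links \<open>smooth_on\<close>, built on Frechet
  derivatives, with \<open>pderiv_at\<close>, built on \<open>deriv\<close>.\<close>

lemma has_real_derivative_line:
  fixes f :: "real ^ 'n::finite \<Rightarrow> real"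
  assumes "f differentiable (at p)"
  shows "((\<lambda>t. f (p + t *\<^sub>R e)) has_real_derivative frechet_derivative f (at p) e) (at 0)"
proof -
  let ?D = "frechet_derivative f (at p)"
  have f: "(f has_derivative ?D) (at (p + 0 *\<^sub>R e))"
    using assms by (simp add: frechet_derivative_works)
  have "((\<lambda>t. f (p + t *\<^sub>R e)) has_derivative (\<lambda>t. ?D (t *\<^sub>R e))) (at 0)"
    by (rule has_derivative_compose[where f = "\<lambda>t. p + t *\<^sub>R e" and g = f, OF _ f])
      (auto intro!: derivative_eq_intros)
  moreover have "linear ?D"
    using f has_derivative_linear by blast
  ultimately show ?thesis
    by (simp add: has_field_derivative_def linear_cmul mult_commute_abs)
qed

lemma pderiv_at_eq_frechet_derivative:
  "f differentiable (at p) \<Longrightarrow> pderiv_at i f p = frechet_derivative f (at p) (axis i 1)"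
  unfolding pderiv_at_def by (intro DERIV_imp_deriv has_real_derivative_line)

text \<open>Where no derivative exists, \<open>deriv\<close> is an unspecified value that need not
  scale with \<open>c\<close>; hence the differentiability assumption.\<close>

lemma pderiv_at_cmult:
  assumes "f differentiable (at p)"
  shows "pderiv_at i (\<lambda>q. c * f q) p = c * pderiv_at i f p"
  unfolding pderiv_at_def
  using has_real_derivative_line[OF assms, of "axis i 1"]
  by (intro deriv_cmult) (auto simp: field_differentiable_def)

lemma pderiv_at_differentiable:
  assumes "smooth_on S f" "open S" "p \<in> S"
  shows "pderiv_at i f differentiable (at p)"
proof -
  have *: "Ck_on (Suc (Suc 0)) S f"
    using assms(1) unfolding smooth_on_def by blast
  then have "(\<lambda>q. frechet_derivative f (at q) (axis i 1)) differentiable (at p)"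
    using assms(3) by simp
  then obtain D where D: "((\<lambda>q. frechet_derivative f (at q) (axis i 1)) has_derivative D) (at p)"
    by (auto simp: differentiable_def)
  have "(pderiv_at i f has_derivative D) (at p)"
    using * by (intro has_derivative_transform_within_open[OF D assms(2,3)])
      (simp add: pderiv_at_eq_frechet_derivative)
  then show ?thesis
    by (auto simp: differentiable_def)
qed

section \<open>The inverse metric\<close>

lemma matrix_inv_eqI:
  fixes A B :: "real ^ 'n ^ 'n"
  assumes "A ** B = mat 1" "B ** A = mat 1"
  shows "matrix_inv A = B"
proof -
  have "A ** matrix_inv A = mat 1 \<and> matrix_inv A ** A = mat 1"
    \<comment> \<open>\<open>matrix_inv\<close> chooses some two-sided inverse; \<open>B\<close>
      shows that there is one to choose.\<close>
    unfolding matrix_inv_def by (rule someI[of _ B]) (simp add: assms)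
  then have "B ** (A ** matrix_inv A) = B"
    by simp
  then show ?thesis
    by (simp add: matrix_mul_assoc assms(2))
qed

text \<open>The (u, v) block with rows (h, 1), (1, 0) has the inverse with rows (0, 1), (1, -h). The
  last equation includes \<open>g\<^sup>u\<^sup>u = 0\<close>.\<close>

fun pp_inv_component :: "real \<Rightarrow> 'd coord \<Rightarrow> 'd coord \<Rightarrow> real" where
  "pp_inv_component h V V = - h"
| "pp_inv_component h U V = 1"
| "pp_inv_component h V U = 1"
| "pp_inv_component h (X \<rho>) (X \<sigma>) = (if \<rho> = \<sigma> then 1 else 0)"
| "pp_inv_component h _ _ = 0"

lemma matrix_inv_pp_component:
  "matrix_inv (\<chi> i j. pp_component h i j) = (\<chi> i j :: 'd::finite coord. pp_inv_component h i j)"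
proof (rule matrix_inv_eqI)
  show "(\<chi> i j. pp_component h i j) ** (\<chi> i j :: 'd coord. pp_inv_component h i j) = mat 1"
    unfolding vec_eq_iff
  proof (intro allI)
    fix i j :: "'d coord"
    show "((\<chi> i j. pp_component h i j) ** (\<chi> i j. pp_inv_component h i j)) $ i $ j = mat 1 $ i $ j"
      by (cases i; cases j)
         (auto simp: matrix_matrix_mult_def mat_def sum_UNIV_coord
            if_distrib[of "\<lambda>x. x * _"] cong: if_cong)
  qed
  show "(\<chi> i j. pp_inv_component h i j) ** (\<chi> i j :: 'd coord. pp_component h i j) = mat 1"
    unfolding vec_eq_iff
  proof (intro allI)
    fix i j :: "'d coord"
    show "((\<chi> i j. pp_inv_component h i j) ** (\<chi> i j. pp_component h i j)) $ i $ j = mat 1 $ i $ j"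
      by (cases i; cases j)
         (auto simp: matrix_matrix_mult_def mat_def sum_UNIV_coord
            if_distrib[of "\<lambda>x. x * _"] cong: if_cong)
  qed
qed

section \<open>\<open>H\<close> as a function on space-time, and its partial derivatives\<close>

definition pp_profile :: "(real ^ 'd \<Rightarrow> real \<Rightarrow> real) \<Rightarrow> real ^ 'd::finite coord \<Rightarrow> real" where
  "pp_profile H p = H (spatial p) (p $ U)"

lemma spatial_line:
  "spatial (p + t *\<^sub>R axis U 1) = spatial p"
  "spatial (p + t *\<^sub>R axis V 1) = spatial p"
  "spatial (p + t *\<^sub>R axis (X \<rho>) 1) = spatial p + t *\<^sub>R axis \<rho> 1"
  by (auto simp: spatial_def vec_eq_iff axis_def)

lemma U_line:
  "(p + t *\<^sub>R axis V 1) $ U = p $ U"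
  "(p + t *\<^sub>R axis (X \<rho>) 1) $ U = p $ U"
  by (auto simp: axis_def)

lemma pderiv_at_translate:
  assumes "\<And>q. f (q + w) = f q"
  shows "pderiv_at i f (p + w) = pderiv_at i f p"
proof -
  have "f (p + w + t *\<^sub>R e) = f (p + t *\<^sub>R e)" for t e
    using assms[of "p + t *\<^sub>R e"] by (simp add: add_ac)
  then show ?thesis by (simp add: pderiv_at_def)
qed

lemma pp_profile_V_line: "pp_profile H (p + t *\<^sub>R axis V 1) = pp_profile H p"
  unfolding pp_profile_def by (simp only: spatial_line U_line)

lemma pderiv_V_pp_profile: "pderiv_at V (pp_profile H) p = 0"
  by (simp only: pderiv_at_def pp_profile_V_line) simp

text \<open>Invariance under translations along v passes from the profile to its partial
  derivatives, which are therefore constant along v-lines. No mixed derivatives are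
  interchanged.\<close>

lemma pderiv_V_pderiv_pp_profile: "pderiv_at V (\<lambda>q. c * pderiv_at i (pp_profile H) q) p = 0"
proof -
  have "pderiv_at i (pp_profile H) (p + t *\<^sub>R axis V 1) = pderiv_at i (pp_profile H) p" for t
    by (rule pderiv_at_translate) (rule pp_profile_V_line)
  then show ?thesis by (simp add: pderiv_at_def[of V])
qed

lemma pderiv_X_pp_profile:
  "pderiv_at (X \<rho>) (pp_profile H) p = pderiv_at \<rho> (\<lambda>y. H y (p $ U)) (spatial p)"
  unfolding pderiv_at_def pp_profile_def by (simp only: spatial_line U_line)

text \<open>Moving along a spatial axis fixes u, so the derivatives are those of a slice of
  \<open>H\<close> at constant u, as they occur in \<open>pp_psi\<close>.\<close>

lemma pderiv_XX_pp_profile: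
  "pderiv_at (X \<rho>) (pderiv_at (X \<rho>) (pp_profile H)) p =
     pderiv_at \<rho> (pderiv_at \<rho> (\<lambda>y. H y (p $ U))) (spatial p)"
  unfolding pderiv_at_def[of "X \<rho>" "pderiv_at (X \<rho>) (pp_profile H)"] pderiv_X_pp_profile
  by (simp only: spatial_line U_line pderiv_at_def[of \<rho> "pderiv_at \<rho> (\<lambda>y. H y (p $ U))"])

section \<open>Christoffel symbols and Ricci tensor\<close>

fun pp_christoffel ::
    "(real ^ 'd::finite coord \<Rightarrow> real) \<Rightarrow> 'd coord \<Rightarrow> 'd coord \<Rightarrow> 'd coord \<Rightarrow> real ^ 'd coord \<Rightarrow> real"
  where
  "pp_christoffel F V U U = (\<lambda>p. 1/2 * pderiv_at U F p)"
| "pp_christoffel F V U (X \<rho>) = (\<lambda>p. 1/2 * pderiv_at (X \<rho>) F p)"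
| "pp_christoffel F V (X \<rho>) U = (\<lambda>p. 1/2 * pderiv_at (X \<rho>) F p)"
| "pp_christoffel F (X \<rho>) U U = (\<lambda>p. -1/2 * pderiv_at (X \<rho>) F p)"
| "pp_christoffel F _ _ _ = (\<lambda>_. 0)"

context
  fixes W :: "(real ^ ('d::finite) coord) set"
    and g :: "'d coord metric"
    and H :: "real ^ 'd \<Rightarrow> real \<Rightarrow> real"
  assumes W: "open W"
    and g: "\<And>p. p \<in> W \<Longrightarrow> g p = pp_metric H p"
begin

lemma inv_metric_pp:
  "p \<in> W \<Longrightarrow> inv_metric g p $ i $ j = pp_inv_component (pp_profile H p) i j"
  by (simp add: inv_metric_def g pp_metric_def matrix_inv_pp_component pp_profile_def)

lemma metric_pp: "p \<in> W \<Longrightarrow> g p $ i $ j = pp_component (pp_profile H p) i j"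
  by (simp add: g pp_metric_def pp_profile_def)

lemma pderiv_metric_pp:
  assumes "p \<in> W"
  shows "pderiv_at m (\<lambda>q. g q $ i $ j) p =
    (if i = U \<and> j = U then pderiv_at m (pp_profile H) p else 0)"
proof -
  have "pderiv_at m (\<lambda>q. g q $ i $ j) p = pderiv_at m (\<lambda>q. pp_component (pp_profile H q) i j) p"
    using W assms by (rule pderiv_at_cong) (rule metric_pp)
  also have "\<dots> = (if i = U \<and> j = U then pderiv_at m (pp_profile H) p else 0)"
    by (cases i; cases j) simp_all
  finally show ?thesis .
qed

text \<open>Only \<open>g\<^sub>u\<^sub>u\<close> varies, and its v-derivative is zero; the latter
  kills all symbols with upper index u, and \<open>\<Gamma>\<^sup>v\<^sub>u\<^sub>v\<close>. The
  entries of \<open>pp_christoffel\<close> are functions so that they can be differentiated in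
  turn.\<close>

lemma christoffel_pp:
  assumes "p \<in> W"
  shows "christoffel g k i j p = pp_christoffel (pp_profile H) k i j p"
  unfolding christoffel_def
  by (cases k; cases i; cases j)
     (auto simp: assms inv_metric_pp pderiv_metric_pp pderiv_V_pp_profile sum_UNIV_coord
        sum_negf if_distrib[of "\<lambda>x. x * _"] cong: if_cong)

lemma pderiv_christoffel_pp:
  "p \<in> W \<Longrightarrow> pderiv_at m (christoffel g k i j) p = pderiv_at m (pp_christoffel (pp_profile H) k i j) p"
  using W by (rule pderiv_at_cong) (auto simp: christoffel_pp)

text \<open>Without summation over \<open>i\<close>: this removes one derivative and one product
  from the formula for \<open>riemann_up g i k i l\<close>.\<close>

lemma pp_christoffel_trace: "pp_christoffel F i i k = (\<lambda>_. 0)"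
  by (cases i; cases k) simp_all

text \<open>If \<open>i\<close> is v, the second factor has v as a lower index; if \<open>i\<close>
  is spatial, the first factor forces \<open>s = U\<close>, which is never an upper index.\<close>

lemma pp_christoffel_square: "pp_christoffel F i l s p * pp_christoffel F s i k p = 0"
  by (cases i; cases l; cases s; cases k) simp_all

lemma pderiv_pp_christoffel:
  assumes "p \<in> W" "smooth_on W (\<lambda>p. g p $ U $ U)"
  shows "pderiv_at i (pp_christoffel (pp_profile H) i l k) p =
    (case i of X \<rho> \<Rightarrow> if k = U \<and> l = U then -1/2 * pderiv_at i (pderiv_at i (pp_profile H)) p else 0
       | _ \<Rightarrow> 0)"
proof -
  \<comment> \<open>Smoothness is given for the component \<open>g\<^sub>u\<^sub>u\<close>, which is
    known to equal the profile only on \<open>W\<close>; differentiability is carried over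
    locally.\<close>
  have eq: "pderiv_at i (\<lambda>p. g p $ U $ U) q = pderiv_at i (pp_profile H) q" if "q \<in> W" for i q
    using that by (simp add: pderiv_metric_pp)
  have "pderiv_at i (pp_profile H) differentiable (at p)" for i
  proof -
    obtain D where "(pderiv_at i (\<lambda>p. g p $ U $ U) has_derivative D) (at p)"
      using pderiv_at_differentiable[OF assms(2) W assms(1)] by (auto simp: differentiable_def)
    then have "(pderiv_at i (pp_profile H) has_derivative D) (at p)"
      using W assms(1) by (rule has_derivative_transform_within_open) (rule eq)
    then show ?thesis by (auto simp: differentiable_def)
  qed
  then have scale: "pderiv_at i (\<lambda>q. c * pderiv_at i (pp_profile H) q) p =
      c * pderiv_at i (pderiv_at i (pp_profile H)) p" for c i
    by (intro pderiv_at_cmult)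
  have scale': "pderiv_at i (\<lambda>q. - (pderiv_at i (pp_profile H) q / 2)) p =
      - (pderiv_at i (pderiv_at i (pp_profile H)) p / 2)" for i
    using scale[of i "-1/2"] by simp
  have V': "pderiv_at V (\<lambda>q. pderiv_at i (pp_profile H) q / 2) p = 0" for i
    using pderiv_V_pderiv_pp_profile[of "1/2" i H p] by simp
  show ?thesis
    by (cases i; cases k; cases l) (simp_all add: scale' V')
qed

lemma ricci_pp:
  assumes "p \<in> W" "smooth_on W (\<lambda>p. g p $ U $ U)"
  shows "ricci g [k, l] p = (if k = U \<and> l = U then pp_psi H (spatial p) (p $ U) else 0)"
proof -
  \<comment> \<open>Only the divergence of the Christoffel symbols is left, and its spatial terms
    add up to minus half the spatial Laplacian of \<open>H\<close>.\<close>
  have "ricci g [k, l] p = (\<Sum>i\<in>UNIV. pderiv_at i (pp_christoffel (pp_profile H) i l k) p)"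
    by (simp add: riemann_up_def christoffel_pp pderiv_christoffel_pp assms(1)
          pp_christoffel_trace pp_christoffel_square)
  also have "\<dots> = (if k = U \<and> l = U then pp_psi H (spatial p) (p $ U) else 0)"
    by (auto simp: pderiv_pp_christoffel[OF assms] sum_UNIV_coord pp_psi_def pderiv_XX_pp_profile
          sum_distrib_left intro!: sum.neutral)
  finally show ?thesis .
qed

text \<open>Such a tensor is a function times a power of the parallel one-form \<open>du\<close>, so covariant
  differentiation only acts on the function.\<close>

lemma cov_deriv_U_supported:
  assumes "p \<in> W" and T: "\<And>is q. q \<in> W \<Longrightarrow> length is = n \<Longrightarrow> set is - {U} \<noteq> {} \<Longrightarrow> T is q = 0"
    and len: "length is = n"
  shows "cov_deriv g T (m # is) p = pderiv_at m (T is) p"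
proof -
  \<comment> \<open>Each correction term vanishes: for \<open>s = U\<close> no Christoffel symbol
    has upper index u, and otherwise the updated index list contains \<open>s\<close>, where
    \<open>T\<close> is zero.\<close>
  have "christoffel g s m (is ! a) p * T (is[a := s]) p = 0" if "a < length is" for a s
  proof (cases "s = U")
    case True
    then show ?thesis using assms(1) by (cases m; cases "is ! a") (simp_all add: christoffel_pp)
  next
    case False
    have "s \<in> set (is[a := s])" using that by (simp add: set_update_memI)
    then show ?thesis using False T[OF assms(1), of "is[a := s]"] len by auto
  qed
  then have "(\<Sum>a<length is. \<Sum>s\<in>UNIV. christoffel g s m (is ! a) p * T (is[a := s]) p) = 0"
    by (intro sum.neutral ballI) (simp del: mult_eq_0_iff)
  then show ?thesis by simp
qed

end

section \<open>Covariant derivatives of the Ricci tensor and their trace\<close>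

theorem proposition3p4:
  fixes W :: "(real ^ ('d::finite) coord) set"
    and g :: "'d coord metric"
    and H :: "real ^ 'd \<Rightarrow> real \<Rightarrow> real"
  assumes dim: "CARD('d) + 2 \<ge> 4"
    and W: "open W"
    and H_smooth: "smooth_on ((\<lambda>p. (spatial p, p $ U)) ` W) (\<lambda>(x, u). H x u)"
    and pp: "pp_wave_on W g"
    and g: "\<And>p. p \<in> W \<Longrightarrow> g p = pp_metric H p"
    and psi: "\<exists>f. \<forall>p\<in>W. pp_psi H (spatial p) (p $ U) = f (p $ U)"
  shows "\<forall>p\<in>W. \<forall>k l. cov_laplacian g (ricci g) [k, l] p = 0"
proof (intro ballI allI)
  fix p k l assume p: "p \<in> W"
  obtain f where f: "\<And>p. p \<in> W \<Longrightarrow> pp_psi H (spatial p) (p $ U) = f (p $ U)"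
    using psi by blast
  have "smooth_on W (\<lambda>p. g p $ U $ U)"
    using pp by (simp add: pp_wave_on_def lorentzian_metric_on_def)
  note ricci = ricci_pp[OF W g _ this]
  have ricci_f: "ricci g [k, l] q = (if k = U \<and> l = U then f (q $ U) else 0)" if "q \<in> W" for k l q
    using that by (simp add: ricci f del: ricci.simps)
  have ricci_0: "ricci g is q = 0" if "q \<in> W" "length is = 2" "set is - {U} \<noteq> {}" for "is" q
    using that by (auto simp: ricci numeral_2_eq_2 length_Suc_conv
          simp del: ricci.simps split: if_splits)
  \<comment> \<open>The u-line through \<open>q\<close> has u-coordinate \<open>q $ U + t\<close>,
    and all other coordinate lines fix u. The sequel uses of this value only that it depends on u
    alone.\<close>
  have D: "cov_deriv g (ricci g) [m, k, l] q =
      (if m = U \<and> k = U \<and> l = U then deriv (\<lambda>t. f (q $ U + t)) 0 else 0)" if q: "q \<in> W" for m k l q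
  proof -
    have "cov_deriv g (ricci g) [m, k, l] q = pderiv_at m (ricci g [k, l]) q"
      by (rule cov_deriv_U_supported[OF W g q, where n = 2]) (simp_all add: ricci_0)
    also have "\<dots> = pderiv_at m (\<lambda>q. if k = U \<and> l = U then f (q $ U) else 0) q"
      using W q by (rule pderiv_at_cong) (rule ricci_f)
    also have "\<dots> = (if m = U \<and> k = U \<and> l = U then deriv (\<lambda>t. f (q $ U + t)) 0 else 0)"
      by (cases m; cases "k = U \<and> l = U") (auto simp: pderiv_at_def axis_def)
    finally show ?thesis .
  qed
  have D_0: "cov_deriv g (ricci g) is q = 0" if "q \<in> W" "length is = 3" "set is - {U} \<noteq> {}" for "is" q
    using that by (auto simp: D numeral_3_eq_3 length_Suc_conv
          simp del: cov_deriv.simps split: if_splits)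
  \<comment> \<open>The gradient again lives on u-indices only, now with rank 3 because the
    derivative index counts, so the same lemma applies to it.\<close>
  have DD: "cov_deriv g (cov_deriv g (ricci g)) [j, m, k, l] p =
      pderiv_at j (cov_deriv g (ricci g) [m, k, l]) p" for j m
    by (rule cov_deriv_U_supported[OF W g p, where n = 3]) (simp_all add: D_0)
  \<comment> \<open>For \<open>m \<noteq> U\<close> the differentiated component is identically zero
    on \<open>W\<close>; for \<open>j = V\<close> it is constant along the line of
    differentiation.\<close>
  have DD_0: "cov_deriv g (cov_deriv g (ricci g)) [j, m, k, l] p = 0" if "m \<noteq> U \<or> j = V" for j m
  proof -
    have "cov_deriv g (cov_deriv g (ricci g)) [j, m, k, l] p =
        pderiv_at j (\<lambda>q. if m = U \<and> k = U \<and> l = U then deriv (\<lambda>t. f (q $ U + t)) 0 else 0) p"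
      unfolding DD using W p by (rule pderiv_at_cong) (rule D)
    also have "\<dots> = 0"
      using that by (cases "m = U \<and> k = U \<and> l = U") (auto simp: pderiv_at_def axis_def)
    finally show ?thesis .
  qed
  have "inv_metric g p $ j $ m * cov_deriv g (cov_deriv g (ricci g)) [j, m, k, l] p = 0" for j m
  proof (cases "m \<noteq> U \<or> j = V")
    case False
    \<comment> \<open>Here \<open>m = U\<close> and \<open>j \<noteq> V\<close>, whereas v is the
      only index that the inverse metric pairs with u.\<close>
    then have "inv_metric g p $ j $ m = 0"
      by (cases j) (auto simp: inv_metric_pp[OF W g p])
    then show ?thesis by simp
  qed (use DD_0 in simp)
  then show "cov_laplacian g (ricci g) [k, l] p = 0"
    by (simp only: cov_laplacian_def sum.neutral_const)
qed

end
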